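(* Let $S$ and $T$ be independent discrete random variables on finite alphabets, let $p(y_1y_2|x_1x_2)$ be a discrete memoryless interference channel with finite alphabets, and let $Q,W_1,W_2,X_1,X_2,Y_1,Y_2$ be random variables on finite alphabets such that $$p(s,t,q,w_1,w_2,x_1,x_2,y_1,y_2)=p(s)\,p(t)\,p(q)\,p(w_1|q)\,p(w_2|q)\,p(x_1|w_1,q)\,p(x_2|w_2,q)\,p(y_1y_2|x_1x_2).$$ Put $R_1=H(S)$ and $R_2=H(T)$. Then the system of conditions \begin{align*} H(S)&<I(SX_1;Y_1|QW_2),\\ H(T)&<I(TX_2;Y_2|QW_1),\\ H(S)+H(T)&<I(SX_1;Y_1|QW_1W_2)+I(W_1TX_2;Y_2|Q),\\ H(S)+H(T)&<I(TX_2;Y_2|QW_1W_2)+I(W_2SX_1;Y_1|Q),\\ H(S)+H(T)&<I(SW_2X_1;Y_1|QW_1)+I(TW_1X_2;Y_2|QW_2),\\ 2H(S)+H(T)&<I(SX_1;Y_1|QW_1W_2)+I(SW_2X_1;Y_1|Q)+I(TW_1X_2;Y_2|QW_2),\\ H(S)+2H(T)&<I(TX_2;Y_2|QW_1W_2)+I(TW_1X_2;Y_2|Q)+I(SW_2X_1;Y_1|QW_1) \end{align*} coincides with (holds if and only if) the system of Han–Kobayashi conditions \begin{align*} R_1&<I(X_1;Y_1|QW_2),\\ R_2&<I(X_2;Y_2|QW_1),\\ R_1+R_2&<I(X_1;Y_1|QW_1W_2)+I(W_1X_2;Y_2|Q),\\ R_1+R_2&<I(X_2;Y_2|QW_1W_2)+I(W_2X_1;Y_1|Q),\\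 R_1+R_2&<I(W_2X_1;Y_1|QW_1)+I(W_1X_2;Y_2|QW_2),\\ 2R_1+R_2&<I(X_1;Y_1|QW_1W_2)+I(W_2X_1;Y_1|Q)+I(W_1X_2;Y_2|QW_2),\\ R_1+2R_2&<I(X_2;Y_2|QW_1W_2)+I(W_1X_2;Y_2|Q)+I(W_2X_1;Y_1|QW_1). \end{align*}
   Context: Juxtaposition of random variables inside $H(\cdot)$ and $I(\cdot;\cdot|\cdot)$ denotes the tuple, e.g. $I(SX_1;Y_1|QW_2)=I((S,X_1);Y_1|(Q,W_2))$. $H$ and $I$ are Shannon entropy and (conditional) mutual information. A discrete memoryless interference channel is a transition probability $p(y_1y_2|x_1x_2)$ from two inputs $X_1,X_2$ to two outputs $Y_1,Y_2$, with finite alphabets. The second system of inequalities describes the (simplified) Han–Kobayashi achievable rate region for the interference channel with independent messages; the first is a sufficient condition for lossless transmission of a source pair $(S,T)$ without common part over the channel. *)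

theory Defs
  imports "HOL-Probability.Probability"
begin

text \<open>
  The abbreviations below are those of the locale \<open>information_space\<close>, with the probability
  space \<open>M\<close> and the base \<open>b\<close> of the logarithm as explicit arguments. The library defines
  \<open>I(X;Y|Z)\<close> by the chain rule, as \<open>I(X;(Y,Z)) - I(X;Z)\<close>. The measures handed to the library are
  the counting measures on the (finite) ranges of the variables; alphabet symbols outside the range
  have probability zero and do not contribute.
\<close>

abbreviation shannon_entropy :: "real \<Rightarrow> 'a measure \<Rightarrow> ('a \<Rightarrow> 'x) \<Rightarrow> real"
    (\<open>H\<^bsub>_,_\<^esub>'(_')\<close>) where
  "H\<^bsub>b,M\<^esub>(X) \<equiv> prob_space.entropy M b (count_space (X ` space M)) X"

abbreviation cond_mutual_info ::
    "real \<Rightarrow> 'a measure \<Rightarrow> ('a \<Rightarrow> 'x) \<Rightarrow> ('a \<Rightarrow> 'y) \<Rightarrow> ('a \<Rightarrow> 'z) \<Rightarrow> real"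
    (\<open>I\<^bsub>_,_\<^esub>'(_ ; _ | _')\<close> [0, 0, 60, 60, 60] 1000) where
  "I\<^bsub>b,M\<^esub>(X ; Y | Z) \<equiv> prob_space.conditional_mutual_information M b
     (count_space (X ` space M)) (count_space (Y ` space M)) (count_space (Z ` space M)) X Y Z"

text \<open>Juxtaposition of random variables: the tuple, viewed as one random variable.\<close>

abbreviation rv_tuple :: "('a \<Rightarrow> 'x) \<Rightarrow> ('a \<Rightarrow> 'y) \<Rightarrow> 'a \<Rightarrow> 'x \<times> 'y" (infixr \<open>\<bowtie>\<close> 65) where
  "X \<bowtie> Y \<equiv> (\<lambda>\<omega>. (X \<omega>, Y \<omega>))"

text \<open>
  For a channel \<open>p\<close>, the transition probability \<open>p(y\<^sub>1y\<^sub>2|x\<^sub>1x\<^sub>2)\<close> is \<open>pmf (p x1 x2) (y1, y2)\<close>.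
  Finiteness of the alphabets is imposed by instantiating the type variables with class \<open>finite\<close>.
\<close>

type_synonym ('x1, 'x2, 'y1, 'y2) interference_channel = "'x1 \<Rightarrow> 'x2 \<Rightarrow> ('y1 \<times> 'y2) pmf"

text \<open>
  The factorization
  \<open>p(s) p(t) p(q) p(w\<^sub>1|q) p(w\<^sub>2|q) p(x\<^sub>1|w\<^sub>1,q) p(x\<^sub>2|w\<^sub>2,q) p(y\<^sub>1y\<^sub>2|x\<^sub>1x\<^sub>2)\<close> of the joint law.
  A conditional probability given a null event is \<open>0\<close> in HOL; this is harmless, since the product
  then also has a factor (or, for \<open>p(x\<^sub>1|w\<^sub>1,q)\<close>, a partial product such as \<open>p(q) p(w\<^sub>1|q)\<close>) equal
  to zero.
\<close>

definition han_kobayashi_factorization ::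
    "'a measure \<Rightarrow> ('x1, 'x2, 'y1, 'y2) interference_channel \<Rightarrow>
     ('a \<Rightarrow> 's) \<Rightarrow> ('a \<Rightarrow> 't) \<Rightarrow> ('a \<Rightarrow> 'q) \<Rightarrow> ('a \<Rightarrow> 'w1) \<Rightarrow> ('a \<Rightarrow> 'w2) \<Rightarrow>
     ('a \<Rightarrow> 'x1) \<Rightarrow> ('a \<Rightarrow> 'x2) \<Rightarrow> ('a \<Rightarrow> 'y1) \<Rightarrow> ('a \<Rightarrow> 'y2) \<Rightarrow> bool" where
  "han_kobayashi_factorization M p S T Q W1 W2 X1 X2 Y1 Y2 \<longleftrightarrow>
    (\<forall>s t q w1 w2 x1 x2 y1 y2.
      \<P>(\<omega> in M. S \<omega> = s \<and> T \<omega> = t \<and> Q \<omega> = q \<and> W1 \<omega> = w1 \<and> W2 \<omega> = w2 \<and>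
               X1 \<omega> = x1 \<and> X2 \<omega> = x2 \<and> Y1 \<omega> = y1 \<and> Y2 \<omega> = y2) =
      \<P>(\<omega> in M. S \<omega> = s) * \<P>(\<omega> in M. T \<omega> = t) * \<P>(\<omega> in M. Q \<omega> = q) *
      \<P>(\<omega> in M. W1 \<omega> = w1 \<bar> Q \<omega> = q) * \<P>(\<omega> in M. W2 \<omega> = w2 \<bar> Q \<omega> = q) *
      \<P>(\<omega> in M. X1 \<omega> = x1 \<bar> W1 \<omega> = w1 \<and> Q \<omega> = q) *
      \<P>(\<omega> in M. X2 \<omega> = x2 \<bar> W2 \<omega> = w2 \<and> Q \<omega> = q) *
      pmf (p x1 x2) (y1, y2))"

end

theory Submission
  imports Defs
begin

text \<open>
  Summing the factorization over all other variables shows that \<open>S\<close>, and likewise \<open>T\<close>, is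
  independent of \<open>(Q, W\<^sub>1, W\<^sub>2, X\<^sub>1, X\<^sub>2, Y\<^sub>1, Y\<^sub>2)\<close>. Adjoining to \<open>X\<close> a variable that is independent
  of \<open>(X, Y, Z)\<close> does not change \<open>I(X;Y|Z)\<close>: in the information density
  \<open>log (p(x,y,z) p(z) / (p(x,z) p(y,z)))\<close> its probability cancels. Hence the two systems agree
  term by term.
\<close>

text \<open>Finite additivity over the fibres of \<open>R\<close>. With \<open>\<phi>\<close>
  constantly true this is marginalization; with \<open>A\<close> constantly true it computes an
  event determined by \<open>R\<close> from the point masses of \<open>R\<close>.\<close>

lemma (in prob_space) prob_conj_eq_sum:
  fixes R :: "'a \<Rightarrow> 'r::finite"
  assumes [measurable]: "R \<in> M \<rightarrow>\<^sub>M count_space UNIV" "Measurable.pred M A"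
  shows "\<P>(\<omega> in M. A \<omega> \<and> \<phi> (R \<omega>)) = (\<Sum>r | \<phi> r. \<P>(\<omega> in M. A \<omega> \<and> R \<omega> = r))"
proof -
  have "{\<omega> \<in> space M. A \<omega> \<and> \<phi> (R \<omega>)} = (\<Union>r\<in>{r. \<phi> r}. {\<omega> \<in> space M. A \<omega> \<and> R \<omega> = r})"
    by auto
  then show ?thesis
    by (simp, intro finite_measure_finite_Union) (auto simp: disjoint_family_on_def)
qed

text \<open>Product form on atoms passes to every event determined by \<open>R\<close>, because both
  sides are sums over the same values \<open>r\<close>. The value of \<open>U\<close> stays fixed,
  since the information densities only ever ask for \<open>U\<close> to equal its current
  value.\<close>

lemma (in prob_space) prob_conj_pred_eq_mult:
  fixes R :: "'a \<Rightarrow> 'r::finite"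
  assumes [measurable]: "U \<in> M \<rightarrow>\<^sub>M count_space UNIV" "R \<in> M \<rightarrow>\<^sub>M count_space UNIV"
    and indep: "\<And>u r. \<P>(\<omega> in M. U \<omega> = u \<and> R \<omega> = r) = \<P>(\<omega> in M. U \<omega> = u) * \<P>(\<omega> in M. R \<omega> = r)"
  shows "\<P>(\<omega> in M. U \<omega> = u \<and> \<phi> (R \<omega>)) = \<P>(\<omega> in M. U \<omega> = u) * \<P>(\<omega> in M. \<phi> (R \<omega>))"
  using prob_conj_eq_sum[of R "\<lambda>\<omega>. U \<omega> = u" \<phi>] prob_conj_eq_sum[of R "\<lambda>\<omega>. True" \<phi>]
  by (simp add: indep sum_distrib_left)

lemma (in prob_space) sum_prob_eq_1:
  fixes U :: "'a \<Rightarrow> 'u::finite"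
  assumes "U \<in> M \<rightarrow>\<^sub>M count_space UNIV"
  shows "(\<Sum>u\<in>UNIV. \<P>(\<omega> in M. U \<omega> = u)) = 1"
  using prob_conj_eq_sum[OF assms, of "\<lambda>\<omega>. True" "\<lambda>r. True"] by (simp add: prob_space)

text \<open>The function \<open>g\<close> is arbitrary and not assumed normalized. Summing out
  \<open>V\<close> leaves \<open>g r\<close> times the mass of \<open>u\<close>; summing out
  \<open>U\<close> as well identifies \<open>g\<close> as the law of \<open>R\<close>, since point
  masses sum to one.\<close>

lemma (in prob_space) prob_eq_mult_of_factorization:
  fixes U :: "'a \<Rightarrow> 'u::finite" and V :: "'a \<Rightarrow> 'v::finite" and R :: "'a \<Rightarrow> 'r"
  assumes [measurable]: "U \<in> M \<rightarrow>\<^sub>M count_space UNIV" "V \<in> M \<rightarrow>\<^sub>M count_space UNIV"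
      "R \<in> M \<rightarrow>\<^sub>M count_space UNIV"
    and factor: "\<And>u v r. \<P>(\<omega> in M. (U \<omega> = u \<and> R \<omega> = r) \<and> V \<omega> = v) =
      \<P>(\<omega> in M. U \<omega> = u) * \<P>(\<omega> in M. V \<omega> = v) * g r"
  shows "\<P>(\<omega> in M. U \<omega> = u \<and> R \<omega> = r) = \<P>(\<omega> in M. U \<omega> = u) * \<P>(\<omega> in M. R \<omega> = r)"
proof -
  have UR: "\<P>(\<omega> in M. U \<omega> = u \<and> R \<omega> = r) = \<P>(\<omega> in M. U \<omega> = u) * g r" for u
    using prob_conj_eq_sum[of V "\<lambda>\<omega>. U \<omega> = u \<and> R \<omega> = r" "\<lambda>v. True"]
    by (simp add: factor[simplified conj_assoc] sum_distrib_left[symmetric] sum_distrib_right[symmetric]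
        sum_prob_eq_1)
  have "\<P>(\<omega> in M. R \<omega> = r) = g r"
    using prob_conj_eq_sum[of U "\<lambda>\<omega>. R \<omega> = r" "\<lambda>v. True"]
    by (simp add: UR conj_commute[of "R _ = r"] sum_distrib_right[symmetric] sum_prob_eq_1)
  with UR show ?thesis by simp
qed

text \<open>The library formula is a sum over the range of \<open>(X, Y, Z)\<close>, which changes
  when a variable is adjoined to \<open>X\<close>. As an expectation of the information density it
  becomes an integral over \<open>M\<close> in all cases, so two such quantities can be compared
  pointwise in \<open>\<omega>\<close>.\<close>

lemma (in information_space) conditional_mutual_information_eq_expectation:
  assumes X: "simple_function M X" and Y: "simple_function M Y" and Z: "simple_function M Z"
  shows "\<I>(X ; Y | Z) = (\<integral>\<omega>. log b (
      \<P>(\<omega>' in M. X \<omega>' = X \<omega> \<and> Y \<omega>' = Y \<omega> \<and> Z \<omega>' = Z \<omega>) /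
      (\<P>(\<omega>' in M. X \<omega>' = X \<omega> \<and> Z \<omega>' = Z \<omega>) *
        (\<P>(\<omega>' in M. Y \<omega>' = Y \<omega> \<and> Z \<omega>' = Z \<omega>) / \<P>(\<omega>' in M. Z \<omega>' = Z \<omega>)))) \<partial>M)"
proof -
  \<comment> \<open>A simple function is distributed according to the measures of its own
    fibres.\<close>
  note simple = simple_distributedI[OF _ measure_nonneg refl]
  let ?XYZ = "\<lambda>\<omega>. (X \<omega>, Y \<omega>, Z \<omega>)"
  note YZ = simple_function_Pair[OF Y Z]
  note XYZ = simple_function_Pair[OF X YZ]
  let ?p = "\<lambda>v. prob (?XYZ -` {v} \<inter> space M)"
  let ?g = "\<lambda>(x, y, z). log b (?p (x, y, z) /
    (prob ((\<lambda>\<omega>. (X \<omega>, Z \<omega>)) -` {(x, z)} \<inter> space M) *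
      (prob ((\<lambda>\<omega>. (Y \<omega>, Z \<omega>)) -` {(y, z)} \<inter> space M) / prob (Z -` {z} \<inter> space M))))"
  have "\<I>(X ; Y | Z) = (\<Sum>v\<in>?XYZ ` space M. ?p v * ?g v)"
    by (subst conditional_mutual_information_eq[OF simple[OF Z] simple[OF YZ]
          simple[OF simple_function_Pair[OF X Z]] simple[OF XYZ]]) (simp add: split_beta')
  also have "\<dots> = (\<integral>v. ?p v * ?g v \<partial>count_space (?XYZ ` space M))"
    using simple_functionD(1)[OF XYZ] by (simp add: lebesgue_integral_count_space_finite)
  \<comment> \<open>Change of variables: \<open>?p\<close> is the density of the triple with respect
    to the counting measure on its range.\<close>
  also have "\<dots> = (\<integral>\<omega>. ?g (?XYZ \<omega>) \<partial>M)"
    by (rule distributed_integral[OF simple_distributed[OF simple[OF XYZ]]]) auto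
  finally show ?thesis
    by (simp add: vimage_def Int_def conj_commute)
qed

text \<open>Each value of mass zero is avoided almost everywhere, and there are only finitely many
  values. This licenses division by the mass of the current value of \<open>U\<close>.\<close>

lemma (in prob_space) AE_prob_eq_nonzero:
  fixes U :: "'a \<Rightarrow> 'u::finite"
  assumes [measurable]: "U \<in> M \<rightarrow>\<^sub>M count_space UNIV"
  shows "AE \<omega> in M. \<P>(\<omega>' in M. U \<omega>' = U \<omega>) \<noteq> 0"
proof -
  have "AE \<omega> in M. \<P>(\<omega>' in M. U \<omega>' = u) = 0 \<longrightarrow> U \<omega> \<noteq> u" for u
    using prob_eq_0[of "{\<omega> \<in> space M. U \<omega> = u}"] by (cases "\<P>(\<omega>' in M. U \<omega>' = u) = 0") auto
  then have "AE \<omega> in M. \<forall>u. \<P>(\<omega>' in M. U \<omega>' = u) = 0 \<longrightarrow> U \<omega> \<noteq> u"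
    by (simp add: AE_all_countable)
  then show ?thesis
    by (rule eventually_mono) auto
qed

text \<open>The variable \<open>V\<close> is the pair \<open>(U, X)\<close>, up to a relabelling of its values.\<close>

lemma (in information_space) conditional_mutual_information_adjoin_indep:
  fixes U :: "'a \<Rightarrow> 'u::finite" and R :: "'a \<Rightarrow> 'r::finite"
  assumes U[measurable]: "U \<in> M \<rightarrow>\<^sub>M count_space UNIV" and R[measurable]: "R \<in> M \<rightarrow>\<^sub>M count_space UNIV"
    and indep: "\<And>u r. \<P>(\<omega> in M. U \<omega> = u \<and> R \<omega> = r) = \<P>(\<omega> in M. U \<omega> = u) * \<P>(\<omega> in M. R \<omega> = r)"
    and V: "V = (\<lambda>\<omega>. v (U \<omega>) (f (R \<omega>)))" and v: "\<And>u x u' x'. v u x = v u' x' \<longleftrightarrow> u = u' \<and> x = x'"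
    and X: "X = (\<lambda>\<omega>. f (R \<omega>))" and Y: "Y = (\<lambda>\<omega>. g (R \<omega>))" and Z: "Z = (\<lambda>\<omega>. h (R \<omega>))"
  shows "\<I>(V ; Y | Z) = \<I>(X ; Y | Z)"
proof -
  have sU: "simple_function M U" and sR: "simple_function M R"
    using U R by (auto simp: simple_function_def finite_subset[OF subset_UNIV] intro!: measurable_sets_Collect)
  have sV: "simple_function M V" and sX: "simple_function M X" and sY: "simple_function M Y"
    and sZ: "simple_function M Z"
    unfolding V X Y Z using sU sR by (auto intro: simple_function_compose1 simple_function_compose2)
  let ?iV = "\<lambda>\<omega>. log b (\<P>(\<omega>' in M. V \<omega>' = V \<omega> \<and> Y \<omega>' = Y \<omega> \<and> Z \<omega>' = Z \<omega>) /
    (\<P>(\<omega>' in M. V \<omega>' = V \<omega> \<and> Z \<omega>' = Z \<omega>) *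
      (\<P>(\<omega>' in M. Y \<omega>' = Y \<omega> \<and> Z \<omega>' = Z \<omega>) / \<P>(\<omega>' in M. Z \<omega>' = Z \<omega>))))"
  let ?iX = "\<lambda>\<omega>. log b (\<P>(\<omega>' in M. X \<omega>' = X \<omega> \<and> Y \<omega>' = Y \<omega> \<and> Z \<omega>' = Z \<omega>) /
    (\<P>(\<omega>' in M. X \<omega>' = X \<omega> \<and> Z \<omega>' = Z \<omega>) *
      (\<P>(\<omega>' in M. Y \<omega>' = Y \<omega> \<and> Z \<omega>' = Z \<omega>) / \<P>(\<omega>' in M. Z \<omega>' = Z \<omega>))))"
  \<comment> \<open>Both information densities depend on \<open>\<omega>\<close> only through
    \<open>U\<close> and \<open>R\<close>; this settles the measurability goals of
    \<open>integral_cong_AE\<close>.\<close>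
  have meas: "(\<lambda>\<omega>. k (U \<omega>) (R \<omega>)) \<in> borel_measurable M" for k :: "'u \<Rightarrow> 'r \<Rightarrow> real"
    using sU sR by (auto intro: borel_measurable_simple_function simple_function_compose2)
  note pred = prob_conj_pred_eq_mult[OF U R indep]
  show ?thesis
    unfolding conditional_mutual_information_eq_expectation[OF sV sY sZ]
      conditional_mutual_information_eq_expectation[OF sX sY sZ]
  proof (rule integral_cong_AE)
    show "AE \<omega> in M. ?iV \<omega> = ?iX \<omega>"
      using AE_prob_eq_nonzero[OF U]
    proof (rule eventually_mono)
      fix \<omega> assume "\<P>(\<omega>' in M. U \<omega>' = U \<omega>) \<noteq> 0"
      \<comment> \<open>Injectivity of \<open>v\<close> splits the event for \<open>V\<close> into
        one for \<open>U\<close> and one for \<open>X\<close>. The mass of \<open>U \<omega>\<close>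
        then appears once in the numerator and once in the denominator. Being nonzero, it cancels,
        whether or not the remaining factors vanish.\<close>
      moreover have "\<P>(\<omega>' in M. V \<omega>' = V \<omega> \<and> Y \<omega>' = Y \<omega> \<and> Z \<omega>' = Z \<omega>) =
          \<P>(\<omega>' in M. U \<omega>' = U \<omega>) * \<P>(\<omega>' in M. X \<omega>' = X \<omega> \<and> Y \<omega>' = Y \<omega> \<and> Z \<omega>' = Z \<omega>)"
        unfolding V v X Y Z
        using pred[of "U \<omega>" "\<lambda>r. f r = f (R \<omega>) \<and> g r = g (R \<omega>) \<and> h r = h (R \<omega>)"] by (simp add: conj_assoc)
      moreover have "\<P>(\<omega>' in M. V \<omega>' = V \<omega> \<and> Z \<omega>' = Z \<omega>) =
          \<P>(\<omega>' in M. U \<omega>' = U \<omega>) * \<P>(\<omega>' in M. X \<omega>' = X \<omega> \<and> Z \<omega>' = Z \<omega>)"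
        unfolding V v X Z
        using pred[of "U \<omega>" "\<lambda>r. f r = f (R \<omega>) \<and> h r = h (R \<omega>)"] by (simp add: conj_assoc)
      ultimately show "?iV \<omega> = ?iX \<omega>"
        by simp
    qed
  qed (unfold V X Y Z, (rule meas)+)
qed

theorem mainTheorem4:
  fixes M :: "'a measure" and b :: real
    and p :: "('x1::finite, 'x2::finite, 'y1::finite, 'y2::finite) interference_channel"
    and S :: "'a \<Rightarrow> 's::finite" and T :: "'a \<Rightarrow> 't::finite"
    and Q :: "'a \<Rightarrow> 'q::finite"
    and W1 :: "'a \<Rightarrow> 'w1::finite" and W2 :: "'a \<Rightarrow> 'w2::finite"
    and X1 :: "'a \<Rightarrow> 'x1" and X2 :: "'a \<Rightarrow> 'x2"
    and Y1 :: "'a \<Rightarrow> 'y1" and Y2 :: "'a \<Rightarrow> 'y2"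
    and R1 R2 :: real
  assumes "information_space M b"
    and "S \<in> M \<rightarrow>\<^sub>M count_space UNIV" and "T \<in> M \<rightarrow>\<^sub>M count_space UNIV"
    and "Q \<in> M \<rightarrow>\<^sub>M count_space UNIV"
    and "W1 \<in> M \<rightarrow>\<^sub>M count_space UNIV" and "W2 \<in> M \<rightarrow>\<^sub>M count_space UNIV"
    and "X1 \<in> M \<rightarrow>\<^sub>M count_space UNIV" and "X2 \<in> M \<rightarrow>\<^sub>M count_space UNIV"
    and "Y1 \<in> M \<rightarrow>\<^sub>M count_space UNIV" and "Y2 \<in> M \<rightarrow>\<^sub>M count_space UNIV"
    and "\<And>s t. \<P>(\<omega> in M. S \<omega> = s \<and> T \<omega> = t) = \<P>(\<omega> in M. S \<omega> = s) * \<P>(\<omega> in M. T \<omega> = t)"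
    and "han_kobayashi_factorization M p S T Q W1 W2 X1 X2 Y1 Y2"
    and "R1 = H\<^bsub>b,M\<^esub>(S)" and "R2 = H\<^bsub>b,M\<^esub>(T)"
  shows "
     (H\<^bsub>b,M\<^esub>(S) < I\<^bsub>b,M\<^esub>(S \<bowtie> X1 ; Y1 | Q \<bowtie> W2) \<and>
      H\<^bsub>b,M\<^esub>(T) < I\<^bsub>b,M\<^esub>(T \<bowtie> X2 ; Y2 | Q \<bowtie> W1) \<and>
      H\<^bsub>b,M\<^esub>(S) + H\<^bsub>b,M\<^esub>(T)
         < I\<^bsub>b,M\<^esub>(S \<bowtie> X1 ; Y1 | Q \<bowtie> W1 \<bowtie> W2) + I\<^bsub>b,M\<^esub>(W1 \<bowtie> T \<bowtie> X2 ; Y2 | Q) \<and>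
      H\<^bsub>b,M\<^esub>(S) + H\<^bsub>b,M\<^esub>(T)
         < I\<^bsub>b,M\<^esub>(T \<bowtie> X2 ; Y2 | Q \<bowtie> W1 \<bowtie> W2) + I\<^bsub>b,M\<^esub>(W2 \<bowtie> S \<bowtie> X1 ; Y1 | Q) \<and>
      H\<^bsub>b,M\<^esub>(S) + H\<^bsub>b,M\<^esub>(T)
         < I\<^bsub>b,M\<^esub>(S \<bowtie> W2 \<bowtie> X1 ; Y1 | Q \<bowtie> W1) + I\<^bsub>b,M\<^esub>(T \<bowtie> W1 \<bowtie> X2 ; Y2 | Q \<bowtie> W2) \<and>
      2 * H\<^bsub>b,M\<^esub>(S) + H\<^bsub>b,M\<^esub>(T)
         < I\<^bsub>b,M\<^esub>(S \<bowtie> X1 ; Y1 | Q \<bowtie> W1 \<bowtie> W2) + I\<^bsub>b,M\<^esub>(S \<bowtie> W2 \<bowtie> X1 ; Y1 | Q) + I\<^bsub>b,M\<^esub>(T \<bowtie> W1 \<bowtie> X2 ; Y2 | Q \<bowtie> W2) \<and>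
      H\<^bsub>b,M\<^esub>(S) + 2 * H\<^bsub>b,M\<^esub>(T)
         < I\<^bsub>b,M\<^esub>(T \<bowtie> X2 ; Y2 | Q \<bowtie> W1 \<bowtie> W2) + I\<^bsub>b,M\<^esub>(T \<bowtie> W1 \<bowtie> X2 ; Y2 | Q) + I\<^bsub>b,M\<^esub>(S \<bowtie> W2 \<bowtie> X1 ; Y1 | Q \<bowtie> W1))
     \<longleftrightarrow>
     (R1 < I\<^bsub>b,M\<^esub>(X1 ; Y1 | Q \<bowtie> W2) \<and>
      R2 < I\<^bsub>b,M\<^esub>(X2 ; Y2 | Q \<bowtie> W1) \<and>
      R1 + R2
         < I\<^bsub>b,M\<^esub>(X1 ; Y1 | Q \<bowtie> W1 \<bowtie> W2) + I\<^bsub>b,M\<^esub>(W1 \<bowtie> X2 ; Y2 | Q) \<and>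
      R1 + R2
         < I\<^bsub>b,M\<^esub>(X2 ; Y2 | Q \<bowtie> W1 \<bowtie> W2) + I\<^bsub>b,M\<^esub>(W2 \<bowtie> X1 ; Y1 | Q) \<and>
      R1 + R2
         < I\<^bsub>b,M\<^esub>(W2 \<bowtie> X1 ; Y1 | Q \<bowtie> W1) + I\<^bsub>b,M\<^esub>(W1 \<bowtie> X2 ; Y2 | Q \<bowtie> W2) \<and>
      2 * R1 + R2
         < I\<^bsub>b,M\<^esub>(X1 ; Y1 | Q \<bowtie> W1 \<bowtie> W2) + I\<^bsub>b,M\<^esub>(W2 \<bowtie> X1 ; Y1 | Q) + I\<^bsub>b,M\<^esub>(W1 \<bowtie> X2 ; Y2 | Q \<bowtie> W2) \<and>
      R1 + 2 * R2
         < I\<^bsub>b,M\<^esub>(X2 ; Y2 | Q \<bowtie> W1 \<bowtie> W2) + I\<^bsub>b,M\<^esub>(W1 \<bowtie> X2 ; Y2 | Q) + I\<^bsub>b,M\<^esub>(W2 \<bowtie> X1 ; Y1 | Q \<bowtie> W1))"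
proof -
  interpret information_space M b by fact
  note [measurable] = assms(2-10)
  \<comment> \<open>All variables other than the two sources, bundled so that every tuple in the two
    systems is a function of \<open>R\<close> and at most one source.\<close>
  define R where "R = (\<lambda>\<omega>. (Q \<omega>, W1 \<omega>, W2 \<omega>, X1 \<omega>, X2 \<omega>, Y1 \<omega>, Y2 \<omega>))"
  have R[measurable]: "R \<in> M \<rightarrow>\<^sub>M count_space UNIV"
    unfolding R_def by measurable
  \<comment> \<open>The factors of the joint law that involve neither \<open>s\<close> nor
    \<open>t\<close>.\<close>
  define g where "g = (\<lambda>(q, w1, w2, x1, x2, y1, y2). \<P>(\<omega> in M. Q \<omega> = q) *
      \<P>(\<omega> in M. W1 \<omega> = w1 \<bar> Q \<omega> = q) * \<P>(\<omega> in M. W2 \<omega> = w2 \<bar> Q \<omega> = q) *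
      \<P>(\<omega> in M. X1 \<omega> = x1 \<bar> W1 \<omega> = w1 \<and> Q \<omega> = q) *
      \<P>(\<omega> in M. X2 \<omega> = x2 \<bar> W2 \<omega> = w2 \<and> Q \<omega> = q) * pmf (p x1 x2) (y1, y2))"
  have factor: "\<P>(\<omega> in M. S \<omega> = s \<and> T \<omega> = t \<and> R \<omega> = r) =
      \<P>(\<omega> in M. S \<omega> = s) * \<P>(\<omega> in M. T \<omega> = t) * g r" for s t r
    using assms(12) unfolding han_kobayashi_factorization_def
    by (cases r) (simp add: R_def g_def mult.assoc)
  \<comment> \<open>Reordered so that \<open>T\<close> is the variable summed out; the mirrored
    statement below sums out \<open>S\<close> instead.\<close>
  have "\<P>(\<omega> in M. (S \<omega> = s \<and> R \<omega> = r) \<and> T \<omega> = t) =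
      \<P>(\<omega> in M. S \<omega> = s) * \<P>(\<omega> in M. T \<omega> = t) * g r" for s t r
    using factor[of s t r] by (simp add: conj_ac)
  note S = prob_eq_mult_of_factorization[OF assms(2,3) R this]
  have "\<P>(\<omega> in M. (T \<omega> = t \<and> R \<omega> = r) \<and> S \<omega> = s) =
      \<P>(\<omega> in M. T \<omega> = t) * \<P>(\<omega> in M. S \<omega> = s) * g r" for s t r
    using factor[of s t r] by (simp add: conj_ac mult.commute)
  note T = prob_eq_mult_of_factorization[OF assms(3,2) R this]
  note dropS = conditional_mutual_information_adjoin_indep[OF assms(2) R S]
  note dropT = conditional_mutual_information_adjoin_indep[OF assms(3) R T]
  \<comment> \<open>The ten equations cover the distinct information terms of the first system. In
    each, \<open>f\<close>, \<open>g\<close> and \<open>h\<close> are coordinate projections of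
    \<open>R\<close>, and \<open>v\<close> records where the source sits in the tuple:
    \<open>Pair\<close> when it comes first.\<close>
  have e1: "I\<^bsub>b,M\<^esub>(S \<bowtie> X1 ; Y1 | Q \<bowtie> W2) = I\<^bsub>b,M\<^esub>(X1 ; Y1 | Q \<bowtie> W2)"
    by (rule dropS[where v="Pair" and f="\<lambda>(q, w1, w2, x1, x2, y1, y2). x1" and g="\<lambda>(q, w1, w2, x1, x2, y1, y2). y1" and h="\<lambda>(q, w1, w2, x1, x2, y1, y2). (q, w2)"])
      (auto simp: R_def)
  have e2: "I\<^bsub>b,M\<^esub>(S \<bowtie> X1 ; Y1 | Q \<bowtie> W1 \<bowtie> W2) = I\<^bsub>b,M\<^esub>(X1 ; Y1 | Q \<bowtie> W1 \<bowtie> W2)"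
    by (rule dropS[where v="Pair" and f="\<lambda>(q, w1, w2, x1, x2, y1, y2). x1" and g="\<lambda>(q, w1, w2, x1, x2, y1, y2). y1" and h="\<lambda>(q, w1, w2, x1, x2, y1, y2). (q, w1, w2)"])
      (auto simp: R_def)
  have e3: "I\<^bsub>b,M\<^esub>(W2 \<bowtie> S \<bowtie> X1 ; Y1 | Q) = I\<^bsub>b,M\<^esub>(W2 \<bowtie> X1 ; Y1 | Q)"
    \<comment> \<open>Here the source stands between \<open>W2\<close> and \<open>X1\<close>, so
      \<open>v\<close> inserts it in the middle.\<close>
    by (rule dropS[where v="\<lambda>u (w, x). (w, u, x)" and f="\<lambda>(q, w1, w2, x1, x2, y1, y2). (w2, x1)" and g="\<lambda>(q, w1, w2, x1, x2, y1, y2). y1" and h="\<lambda>(q, w1, w2, x1, x2, y1, y2). q"])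
      (auto simp: R_def)
  have e4: "I\<^bsub>b,M\<^esub>(S \<bowtie> W2 \<bowtie> X1 ; Y1 | Q \<bowtie> W1) = I\<^bsub>b,M\<^esub>(W2 \<bowtie> X1 ; Y1 | Q \<bowtie> W1)"
    by (rule dropS[where v="Pair" and f="\<lambda>(q, w1, w2, x1, x2, y1, y2). (w2, x1)" and g="\<lambda>(q, w1, w2, x1, x2, y1, y2). y1" and h="\<lambda>(q, w1, w2, x1, x2, y1, y2). (q, w1)"])
      (auto simp: R_def)
  have e5: "I\<^bsub>b,M\<^esub>(S \<bowtie> W2 \<bowtie> X1 ; Y1 | Q) = I\<^bsub>b,M\<^esub>(W2 \<bowtie> X1 ; Y1 | Q)"
    by (rule dropS[where v="Pair" and f="\<lambda>(q, w1, w2, x1, x2, y1, y2). (w2, x1)" and g="\<lambda>(q, w1, w2, x1, x2, y1, y2). y1" and h="\<lambda>(q, w1, w2, x1, x2, y1, y2). q"])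
      (auto simp: R_def)
  have e6: "I\<^bsub>b,M\<^esub>(T \<bowtie> X2 ; Y2 | Q \<bowtie> W1) = I\<^bsub>b,M\<^esub>(X2 ; Y2 | Q \<bowtie> W1)"
    by (rule dropT[where v="Pair" and f="\<lambda>(q, w1, w2, x1, x2, y1, y2). x2" and g="\<lambda>(q, w1, w2, x1, x2, y1, y2). y2" and h="\<lambda>(q, w1, w2, x1, x2, y1, y2). (q, w1)"])
      (auto simp: R_def)
  have e7: "I\<^bsub>b,M\<^esub>(T \<bowtie> X2 ; Y2 | Q \<bowtie> W1 \<bowtie> W2) = I\<^bsub>b,M\<^esub>(X2 ; Y2 | Q \<bowtie> W1 \<bowtie> W2)"
    by (rule dropT[where v="Pair" and f="\<lambda>(q, w1, w2, x1, x2, y1, y2). x2" and g="\<lambda>(q, w1, w2, x1, x2, y1, y2). y2" and h="\<lambda>(q, w1, w2, x1, x2, y1, y2). (q, w1, w2)"])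
      (auto simp: R_def)
  have e8: "I\<^bsub>b,M\<^esub>(W1 \<bowtie> T \<bowtie> X2 ; Y2 | Q) = I\<^bsub>b,M\<^esub>(W1 \<bowtie> X2 ; Y2 | Q)"
    by (rule dropT[where v="\<lambda>u (w, x). (w, u, x)" and f="\<lambda>(q, w1, w2, x1, x2, y1, y2). (w1, x2)" and g="\<lambda>(q, w1, w2, x1, x2, y1, y2). y2" and h="\<lambda>(q, w1, w2, x1, x2, y1, y2). q"])
      (auto simp: R_def)
  have e9: "I\<^bsub>b,M\<^esub>(T \<bowtie> W1 \<bowtie> X2 ; Y2 | Q \<bowtie> W2) = I\<^bsub>b,M\<^esub>(W1 \<bowtie> X2 ; Y2 | Q \<bowtie> W2)"
    by (rule dropT[where v="Pair" and f="\<lambda>(q, w1, w2, x1, x2, y1, y2). (w1, x2)" and g="\<lambda>(q, w1, w2, x1, x2, y1, y2). y2" and h="\<lambda>(q, w1, w2, x1, x2, y1, y2). (q, w2)"])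
      (auto simp: R_def)
  have e10: "I\<^bsub>b,M\<^esub>(T \<bowtie> W1 \<bowtie> X2 ; Y2 | Q) = I\<^bsub>b,M\<^esub>(W1 \<bowtie> X2 ; Y2 | Q)"
    by (rule dropT[where v="Pair" and f="\<lambda>(q, w1, w2, x1, x2, y1, y2). (w1, x2)" and g="\<lambda>(q, w1, w2, x1, x2, y1, y2). y2" and h="\<lambda>(q, w1, w2, x1, x2, y1, y2). q"])
      (auto simp: R_def)
  \<comment> \<open>After rewriting, both sides are literally the same conjunction.\<close>
  show ?thesis
    unfolding assms(13,14) e1 e2 e3 e4 e5 e6 e7 e8 e9 e10 ..
qed

end
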